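(* Let $H$ be a complex Hilbert space (of arbitrary dimension), let $T \in B(H)$ be written as $T = A + iB$ with $A, B \in B(H)$ self-adjoint, and let $n \ge 2$ be an integer. If $T^n = 0$ and at least one of $A \ge 0$ or $B \ge 0$ holds, then $T = 0$.
   Context: $B(H)$ denotes the algebra of bounded linear operators from $H$ to $H$. Every $T \in B(H)$ can be written uniquely as $T = A + iB$ with $A, B \in B(H)$ self-adjoint, namely $A = \operatorname{Re} T = (T+T^* )/2$ and $B = \operatorname{Im} T = (T-T^* )/(2i)$. An operator $S \in B(H)$ is positive, written $S \ge 0$, if $\langle Sx, x\rangle \ge 0$ for all $x \in H$. *)

theory Defs
  imports "HOL-Analysis.Analysis"
begin

text \<open>
  The distribution has real inner product spaces but no complex ones, so complex Hilbert spaces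
  are introduced here as type classes over the existing real hierarchy.
\<close>

class complex_vector = real_vector +
  fixes scaleC :: "complex \<Rightarrow> 'a \<Rightarrow> 'a" (infixr "*\<^sub>C" 75)
  assumes scaleC_add_right: "a *\<^sub>C (x + y) = a *\<^sub>C x + a *\<^sub>C y"
    and scaleC_add_left: "(a + b) *\<^sub>C x = a *\<^sub>C x + b *\<^sub>C x"
    and scaleC_scaleC: "a *\<^sub>C (b *\<^sub>C x) = (a * b) *\<^sub>C x"
    and scaleC_one: "1 *\<^sub>C x = x"
    and scaleR_scaleC: "r *\<^sub>R x = complex_of_real r *\<^sub>C x"

text \<open>The inner product is linear in its first argument and conjugate-linear in the second.\<close>

class complex_inner = complex_vector + real_normed_vector +
  fixes cinner :: "'a \<Rightarrow> 'a \<Rightarrow> complex"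
  assumes cinner_commute: "cinner x y = cnj (cinner y x)"
    and cinner_add_left: "cinner (x + y) z = cinner x z + cinner y z"
    and cinner_scaleC_left: "cinner (c *\<^sub>C x) y = c * cinner x y"
    and cinner_ge_zero: "cinner x x \<in> \<real>\<^sub>\<ge>\<^sub>0"
    and cinner_eq_zero_iff: "cinner x x = 0 \<longleftrightarrow> x = 0"
    and norm_eq_sqrt_cinner: "norm x = sqrt (Re (cinner x x))"

class chilbert_space = complex_inner + complete_space

instantiation complex :: chilbert_space
begin

definition scaleC_complex :: "complex \<Rightarrow> complex \<Rightarrow> complex"
  where "scaleC_complex c x = c * x"

definition cinner_complex :: "complex \<Rightarrow> complex \<Rightarrow> complex"
  where "cinner_complex x y = x * cnj y"

instance
proof
  fix x :: complex
  have "cinner x x = complex_of_real ((cmod x)\<^sup>2)"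
    by (simp only: cinner_complex_def complex_norm_square)
  then show "cinner x x \<in> \<real>\<^sub>\<ge>\<^sub>0" and "norm x = sqrt (Re (cinner x x))"
    by simp_all
qed (auto simp: scaleC_complex_def cinner_complex_def algebra_simps scaleR_conv_of_real)

end

text \<open>
  \<open>bounded_linear\<close> is real-linearity together with boundedness; compatibility with complex scalars
  is added to it.
\<close>

definition bounded_clinear :: "('a::complex_inner \<Rightarrow> 'b::complex_inner) \<Rightarrow> bool"
  where "bounded_clinear T \<longleftrightarrow> bounded_linear T \<and> (\<forall>c x. T (c *\<^sub>C x) = c *\<^sub>C T x)"

definition is_cadjoint :: "('b::complex_inner \<Rightarrow> 'a::complex_inner) \<Rightarrow> ('a \<Rightarrow> 'b) \<Rightarrow> bool"
  where "is_cadjoint S T \<longleftrightarrow> (\<forall>x y. cinner (T x) y = cinner x (S y))"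

definition selfadjoint :: "('a::complex_inner \<Rightarrow> 'a) \<Rightarrow> bool"
  where "selfadjoint T \<longleftrightarrow> is_cadjoint T T"

text \<open>
  Membership in \<open>\<real>\<^sub>\<ge>\<^sub>0\<close> says that the complex number is real and nonnegative.
\<close>

definition positive_op :: "('a::complex_inner \<Rightarrow> 'a) \<Rightarrow> bool"
  where "positive_op S \<longleftrightarrow> (\<forall>x. cinner (S x) x \<in> \<real>\<^sub>\<ge>\<^sub>0)"

end

theory Submission imports Defs begin

text \<open>
  If \<open>T x = 0\<close>, then the real and imaginary parts \<open>\<langle>A x, x\<rangle>\<close> and \<open>\<langle>B x, x\<rangle>\<close> of \<open>\<langle>T x, x\<rangle>\<close> vanish;
  positivity of one of the operators forces it to annihilate \<open>x\<close>, and then so does the other. Hence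
  \<open>ker T \<subseteq> ker A \<inter> ker B \<subseteq> ker T\<^sup>*\<close>. Since \<open>ker T\<^sup>*\<close> is orthogonal to the range of \<open>T\<close>, this gives
  \<open>ker T\<^sup>2 = ker T\<close>, so a nilpotent \<open>T\<close> is zero.
\<close>

lemma cinner_scaleC_right: "cinner x (c *\<^sub>C y) = cnj c * cinner x y"
  by (metis cinner_commute cinner_scaleC_left complex_cnj_mult)

lemma cinner_add_right: "cinner x (y + z) = cinner x y + cinner x z"
  by (metis cinner_commute cinner_add_left complex_cnj_add)

lemma cinner_zero_left [simp]: "cinner 0 x = 0"
  using cinner_add_left[of 0 0 x] by simp

lemma scaleC_zero_right [simp]: "c *\<^sub>C 0 = 0"
  using scaleC_add_right[of c 0 0] by simp

lemma bounded_clinear_zero: "bounded_clinear T \<Longrightarrow> T 0 = 0"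
  by (simp add: bounded_clinear_def linear_simps)

text \<open>Along the real line \<open>x + t y\<close> with \<open>y = P x\<close>, the form of
  \<open>P\<close> has no constant term, so it equals \<open>2 t N + t^2 c\<close> with
  \<open>N\<close> the squared norm of \<open>y\<close>. Nonnegativity for every real
  \<open>t\<close> forces \<open>N = 0\<close>.\<close>

lemma positive_op_eq_zero:
  assumes "bounded_clinear P" and "selfadjoint P" and "positive_op P"
    and "cinner (P x) x = 0"
  shows "P x = 0"
proof -
  define y where "y = P x"
  define N where "N = Re (cinner y y)"
  define c where "c = Re (cinner (P y) y)"
  have c: "c \<ge> 0"
    using assms(3) by (auto simp: c_def positive_op_def complex_nonneg_Reals_iff)
  have yy: "cinner y y = complex_of_real N"
    using cinner_ge_zero[of y]
    by (auto simp: N_def complex_nonneg_Reals_iff complex_eq_iff)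
  have "cinner (P y) x = cinner y y"
    using assms(2) by (simp add: selfadjoint_def is_cadjoint_def y_def)
  then have quadratic: "Re (cinner (P (x + complex_of_real t *\<^sub>C y)) (x + complex_of_real t *\<^sub>C y))
      = 2 * t * N + t\<^sup>2 * c" for t
    using assms(1,4)
    by (simp add: bounded_clinear_def linear_simps cinner_add_left cinner_add_right
        cinner_scaleC_left cinner_scaleC_right y_def[symmetric] yy c_def power2_eq_square
        distrib_left mult_ac)
  have "0 \<le> 2 * t * N + t\<^sup>2 * c" for t
    unfolding quadratic[symmetric]
    using assms(3) by (auto simp: positive_op_def complex_nonneg_Reals_iff)
  \<comment> \<open>The minimiser would be \<open>- N / c\<close>; the shift to \<open>c + 1\<close>
    also covers \<open>c = 0\<close> and still makes the value negative unless
    \<open>N = 0\<close>.\<close>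
  from this[of "- N / (c + 1)"] have "0 \<le> 2 * (- N / (c + 1)) * N + (- N / (c + 1))\<^sup>2 * c" .
  also have "\<dots> = - (N\<^sup>2 * (c + 2)) / (c + 1)\<^sup>2"
    using c by (simp add: divide_simps power2_eq_square) (simp add: algebra_simps)
  finally have "0 \<le> - (N\<^sup>2 * (c + 2)) / (c + 1)\<^sup>2" .
  then have "N\<^sup>2 * (c + 2) \<le> 0"
    using c by (simp add: divide_simps split: if_splits)
  then have "N = 0"
    using c by (simp add: mult_le_0_iff)
  then show ?thesis
    using yy cinner_eq_zero_iff[of y] by (simp add: y_def)
qed

lemma cartesian_parts_eq_zero:
  assumes "bounded_clinear A" and "bounded_clinear B"
    and "selfadjoint A" and "selfadjoint B"
    and "positive_op A \<or> positive_op B"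
    and "A x + \<i> *\<^sub>C B x = 0"
  shows "A x = 0" and "B x = 0"
proof -
  have real: "Im (cinner (S x) x) = 0" if "selfadjoint S" for S :: "'a \<Rightarrow> 'a"
    using cinner_commute[of "S x" x] that
    by (simp add: selfadjoint_def is_cadjoint_def complex_eq_iff)
  have "cinner (A x) x + \<i> * cinner (B x) x = 0"
    using assms(6) by (metis cinner_add_left cinner_scaleC_left cinner_zero_left)
  then have "cinner (A x) x = 0" and "cinner (B x) x = 0"
    using real[OF assms(3)] real[OF assms(4)] by (auto simp: complex_eq_iff)
  then have "A x = 0 \<or> B x = 0"
    using positive_op_eq_zero assms(1-5) by blast
  \<comment> \<open>Only this direction requires cancelling \<i>; if \<open>B x = 0\<close>, the
    equation reduces to \<open>A x = 0\<close> directly.\<close>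
  moreover have "B x = 0" if "A x = 0"
  proof -
    have "(- \<i>) *\<^sub>C (\<i> *\<^sub>C B x) = 0"
      using assms(6) that by simp
    then show ?thesis
      by (simp add: scaleC_scaleC scaleC_one)
  qed
  ultimately show "A x = 0" and "B x = 0"
    using assms(6) by auto
qed

theorem theorem2p1:
  fixes T A B :: "'a::chilbert_space \<Rightarrow> 'a" and n :: nat
  assumes "bounded_clinear T" and "bounded_clinear A" and "bounded_clinear B"
    and "selfadjoint A" and "selfadjoint B"
    and "T = (\<lambda>x. A x + \<i> *\<^sub>C B x)"
    and "n \<ge> 2"
    and "T ^^ n = (\<lambda>x. 0)"
    and "positive_op A \<or> positive_op B"
  shows "T = (\<lambda>x. 0)"
proof -
  have T: "T x = A x + \<i> *\<^sub>C B x" for x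
    by (simp add: assms(6))
  \<comment> \<open>\<open>A\<close> and \<open>B\<close> annihilate \<open>T y\<close>; moving them
    across the inner product makes \<open>T y\<close> orthogonal to itself.\<close>
  have kernel: "T y = 0" if "T (T y) = 0" for y
  proof -
    have "A (T y) = 0" and "B (T y) = 0"
      using cartesian_parts_eq_zero[OF assms(2-5,9)] that T by metis+
    then have "cinner (T y) (A y) = 0" and "cinner (T y) (B y) = 0"
      using assms(4,5) by (metis selfadjoint_def is_cadjoint_def cinner_zero_left)+
    then have "cinner (T y) (A y + \<i> *\<^sub>C B y) = 0"
      by (simp add: cinner_add_right cinner_scaleC_right)
    then show ?thesis
      by (simp add: T[symmetric] cinner_eq_zero_iff)
  qed
  \<comment> \<open>Peeling off the innermost \<open>T\<close> lets the induction hypothesis apply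
    to \<open>T x\<close>, giving \<open>T (T x) = 0\<close>.\<close>
  have "T x = 0" if "(T ^^ k) x = 0" for k x
    using that
  proof (induction k arbitrary: x)
    case 0
    then show ?case
      by (simp add: bounded_clinear_zero[OF assms(1)])
  next
    case (Suc k)
    then show ?case
      by (auto simp: funpow_Suc_right simp del: funpow.simps intro: kernel)
  qed
  then show ?thesis
    using assms(8) by (metis (no_types))
qed

end
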